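(* Let $\mathbb{A}$ be a nonnegative primitive tensor with order $m\ge 2$ and dimension $n$. Then its primitive degree satisfies $\gamma(\mathbb{A})\le 2^{n^m}$.
   Context: An order $m$ dimension $n$ tensor is an array $\mathbb{A}=(a_{i_1\cdots i_m})$ indexed by $[n]^m$, $[n]=\{1,\dots,n\}$; it is nonnegative if all entries are real and $\ge 0$. For $x\in\mathbb{R}^n$, $(\mathbb{A}x)_i=\sum_{i_2,\dots,i_m=1}^n a_{ii_2\cdots i_m}x_{i_2}\cdots x_{i_m}$. For nonnegative $\mathbb{A}$, let $T_{\mathbb{A}}(x)=(\mathbb{A}x)^{[\frac{1}{m-1}]}$ (componentwise $(m-1)$-th root) for nonnegative vectors $x\in\mathbb{R}^n$. $\mathbb{A}$ is primitive if there is a positive integer $r$ such that $T_{\mathbb{A}}^r(x)>0$ (all components positive; $T_{\mathbb{A}}^r$ the $r$-fold iterate) for all nonnegative nonzero $x\in\mathbb{R}^n$; the smallest such $r$ is the primitive degree $\gamma(\mathbb{A})$. *)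

theory Defs
  imports "HOL-Analysis.Analysis"
begin

text \<open>
  The index set \<open>[n]\<close> is a finite type \<open>'n\<close> with \<open>n = CARD('n)\<close>. A tensor of order \<open>m\<close> is a function
  on index lists, of which only the values at lists of length \<open>m\<close> are relevant: the entry
  with indices \<open>i\<^sub>1, \<dots>, i\<^sub>m\<close> is \<open>A [i\<^sub>1, \<dots>, i\<^sub>m]\<close>. The definitions below read no other values.
\<close>

type_synonym 'n tensor = "'n list \<Rightarrow> real"

definition nonneg_tensor :: "nat \<Rightarrow> 'n tensor \<Rightarrow> bool" where
  "nonneg_tensor m A \<longleftrightarrow> (\<forall>is. length is = m \<longrightarrow> 0 \<le> A is)"

definition tensor_apply :: "nat \<Rightarrow> 'n::finite tensor \<Rightarrow> real ^ 'n \<Rightarrow> real ^ 'n" where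
  "tensor_apply m A x =
     (\<chi> i. \<Sum>js \<in> {js. length js = m - 1}. A (i # js) * (\<Prod>j\<leftarrow>js. x $ j))"

definition tensor_map :: "nat \<Rightarrow> 'n::finite tensor \<Rightarrow> real ^ 'n \<Rightarrow> real ^ 'n" where
  "tensor_map m A x = (\<chi> i. root (m - 1) (tensor_apply m A x $ i))"

definition primitive_exponent :: "nat \<Rightarrow> 'n::finite tensor \<Rightarrow> nat \<Rightarrow> bool" where
  "primitive_exponent m A r \<longleftrightarrow>
     0 < r \<and> (\<forall>x. (\<forall>i. 0 \<le> x $ i) \<and> x \<noteq> 0 \<longrightarrow> (\<forall>i. 0 < (tensor_map m A ^^ r) x $ i))"

definition primitive_tensor :: "nat \<Rightarrow> 'n::finite tensor \<Rightarrow> bool" where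
  "primitive_tensor m A \<longleftrightarrow> (\<exists>r. primitive_exponent m A r)"

definition primitive_degree :: "nat \<Rightarrow> 'n::finite tensor \<Rightarrow> nat" where
  "primitive_degree m A = (LEAST r. primitive_exponent m A r)"

end

theory Submission imports Defs
begin

text \<open>
  For nonnegative \<open>x\<close> the support of \<open>T\<^sub>A x\<close> depends only on the support of \<open>x\<close>, so primitivity is
  a statement about a monotone self-map \<open>F\<close> of the \<open>2\<^sup>n\<close> subsets of the index set: every nonempty
  set is eventually mapped to the full set, which is a fixed point of \<open>F\<close>. An orbit that reaches a
  fixed point passes through distinct sets before, so it needs fewer than \<open>2\<^sup>n\<close> steps.
\<close>

lemma funpow_card_reaches_fixpoint:
  fixes f :: "'a::finite \<Rightarrow> 'a"
  assumes fixpoint: "f c = c" and reach: "(f ^^ r) x = c"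
  shows "(f ^^ CARD('a)) x = c"
proof -
  define N where "N = (LEAST k. (f ^^ k) x = c)"
  have hit: "(f ^^ N) x = c"
    unfolding N_def using reach by (rule LeastI)
  have "(f ^^ i) x \<noteq> (f ^^ j) x" if "i < j" "j \<le> N" for i j
  proof
    assume eq: "(f ^^ i) x = (f ^^ j) x"
    \<comment> \<open>Cutting the loop from time \<open>i\<close> to time \<open>j\<close> out of
      the orbit gives a visit to \<open>c\<close> at time \<open>N - j + i\<close>, which is less
      than \<open>N\<close>.\<close>
    have "(f ^^ (N - j + i)) x = (f ^^ (N - j)) ((f ^^ j) x)"
      by (simp add: funpow_add eq)
    also have "\<dots> = (f ^^ (N - j + j)) x"
      by (simp only: funpow_add o_apply)
    also have "\<dots> = c"
      using hit that by simp
    finally have "N \<le> N - j + i"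
      unfolding N_def by (rule Least_le)
    with that show False by linarith
  qed
  then have "inj_on (\<lambda>k. (f ^^ k) x) {..N}"
    by (intro linorder_inj_onI) auto
  then have "card {..N} \<le> CARD('a)"
    by (rule card_inj_on_le) auto
  \<comment> \<open>The set \<open>{..N}\<close> has \<open>N + 1\<close> elements, so this gives
    away one step. The remaining \<open>CARD('a) - N\<close> steps are spent at the fixed
    point.\<close>
  then have "N \<le> CARD('a)"
    by simp
  then obtain k where k: "CARD('a) = k + N"
    unfolding le_iff_add by (auto simp: add.commute)
  have "(f ^^ k) c = c"
    by (induction k) (simp_all add: fixpoint)
  then show ?thesis
    unfolding k by (simp add: funpow_add hit)
qed

definition pos_support :: "real ^ 'n \<Rightarrow> 'n set" where
  "pos_support x = {i. 0 < x $ i}"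

text \<open>The map \<open>F\<close> of the overview. The list \<open>js\<close> stands for a
  monomial in component \<open>i\<close> that has a positive coefficient and involves only variables
  from \<open>S\<close>.\<close>

definition support_map :: "nat \<Rightarrow> 'n tensor \<Rightarrow> 'n set \<Rightarrow> 'n set" where
  "support_map m A S = {i. \<exists>js. length js = m - 1 \<and> 0 < A (i # js) \<and> set js \<subseteq> S}"

lemma support_map_mono: "S \<subseteq> S' \<Longrightarrow> support_map m A S \<subseteq> support_map m A S'"
  unfolding support_map_def by blast

lemma prod_list_nonneg_pos_iff:
  fixes f :: "'a \<Rightarrow> 'b::linordered_idom"
  assumes "\<And>j. 0 \<le> f j"
  shows "0 \<le> (\<Prod>j\<leftarrow>js. f j)" "0 < (\<Prod>j\<leftarrow>js. f j) \<longleftrightarrow> (\<forall>j\<in>set js. 0 < f j)"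
proof -
  show nonneg: "0 \<le> (\<Prod>j\<leftarrow>js. f j)" for js
    by (induction js) (simp_all add: assms)
  show "0 < (\<Prod>j\<leftarrow>js. f j) \<longleftrightarrow> (\<forall>j\<in>set js. 0 < f j)"
  proof (induction js)
    case (Cons j js)
    then show ?case
      using assms[of j] nonneg[of js] by (auto simp: zero_less_mult_iff)
  qed simp
qed

lemma sum_pos_iff:
  fixes f :: "'a \<Rightarrow> 'b::linordered_idom"
  assumes "finite I" and nonneg: "\<And>i. i \<in> I \<Longrightarrow> 0 \<le> f i"
  shows "0 < sum f I \<longleftrightarrow> (\<exists>i\<in>I. 0 < f i)"
proof -
  have "sum f I = 0 \<longleftrightarrow> (\<forall>i\<in>I. f i = 0)"
    using assms by (rule sum_nonneg_eq_0_iff)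
  moreover have "0 \<le> sum f I"
    using nonneg by (rule sum_nonneg)
  ultimately show ?thesis
    using nonneg by (metis less_le)
qed

text \<open>All terms of a component are nonnegative, so nothing cancels: the component is positive
  iff some term is, and a term is positive iff its coefficient and all its variables are.\<close>

lemma
  fixes A :: "'n::finite tensor"
  assumes "m \<ge> 2" and A: "nonneg_tensor m A" and x: "\<And>j. 0 \<le> x $ j"
  shows tensor_map_nonneg: "0 \<le> tensor_map m A x $ i"
    and pos_support_tensor_map: "pos_support (tensor_map m A x) = support_map m A (pos_support x)"
proof -
  let ?t = "\<lambda>i js. A (i # js) * (\<Prod>j\<leftarrow>js. x $ j)"
  let ?L = "{js :: 'n list. length js = m - 1}"
  have fin: "finite ?L"
    using finite_lists_length_eq[of "UNIV :: 'n set" "m - 1"] by simp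
  have entry: "0 \<le> A (i # js)" if "js \<in> ?L" for i js
    using A that \<open>m \<ge> 2\<close> by (simp add: nonneg_tensor_def)
  have term_nonneg: "0 \<le> ?t i js" if "js \<in> ?L" for i js
    using entry[OF that] prod_list_nonneg_pos_iff(1)[of "\<lambda>j. x $ j"] x by simp
  then have "0 \<le> sum (?t i) ?L"
    by (rule sum_nonneg)
  then show "0 \<le> tensor_map m A x $ i"
    using \<open>m \<ge> 2\<close> by (simp add: tensor_map_def tensor_apply_def)
  have "i \<in> pos_support (tensor_map m A x) \<longleftrightarrow> i \<in> support_map m A (pos_support x)" for i
  proof -
    \<comment> \<open>Since \<open>m - 1 > 0\<close>, the root preserves the sign;
      \<open>root 0\<close> would be constantly 0.\<close>
    have "i \<in> pos_support (tensor_map m A x) \<longleftrightarrow> 0 < sum (?t i) ?L"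
      using \<open>m \<ge> 2\<close> by (simp add: pos_support_def tensor_map_def tensor_apply_def)
    also have "\<dots> \<longleftrightarrow> (\<exists>js\<in>?L. 0 < ?t i js)"
      by (rule sum_pos_iff[OF fin]) (rule term_nonneg)
    also have "\<dots> \<longleftrightarrow> (\<exists>js\<in>?L. 0 < A (i # js) \<and> set js \<subseteq> pos_support x)"
    proof (rule bex_cong[OF refl])
      fix js assume "js \<in> ?L"
      then show "0 < ?t i js \<longleftrightarrow> 0 < A (i # js) \<and> set js \<subseteq> pos_support x"
        using entry[of js i] prod_list_nonneg_pos_iff[of "\<lambda>j. x $ j" js] x
        by (auto simp: zero_less_mult_iff pos_support_def)
    qed
    finally show ?thesis
      by (simp add: support_map_def)
  qed
  then show "pos_support (tensor_map m A x) = support_map m A (pos_support x)"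
    by blast
qed

lemma pos_support_tensor_map_funpow:
  fixes A :: "'n::finite tensor"
  assumes "m \<ge> 2" and "nonneg_tensor m A" and "\<And>j. 0 \<le> x $ j"
  shows "pos_support ((tensor_map m A ^^ k) x) = (support_map m A ^^ k) (pos_support x)"
proof -
  \<comment> \<open>The one-step result applies only to nonnegative vectors, so nonnegativity is
    carried along the orbit.\<close>
  have nonneg: "0 \<le> (tensor_map m A ^^ k) x $ j" for k j
    by (induction k arbitrary: j) (simp_all add: assms tensor_map_nonneg)
  show ?thesis
    by (induction k) (simp_all add: assms nonneg pos_support_tensor_map)
qed

lemma primitive_exponent_iff_support_map:
  fixes A :: "'n::finite tensor"
  assumes "m \<ge> 2" and "nonneg_tensor m A"
  shows "primitive_exponent m A r \<longleftrightarrow>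
    0 < r \<and> (\<forall>S. S \<noteq> {} \<longrightarrow> (support_map m A ^^ r) S = UNIV)"
proof -
  have pos: "(\<forall>i. 0 < (tensor_map m A ^^ r) x $ i) \<longleftrightarrow>
      (support_map m A ^^ r) (pos_support x) = UNIV" if "\<forall>i. 0 \<le> x $ i" for x :: "real ^ 'n"
    using pos_support_tensor_map_funpow[OF assms, of x r] that
    by (auto simp: pos_support_def)
  have nonempty: "x \<noteq> 0 \<longleftrightarrow> pos_support x \<noteq> {}" if "\<forall>i. 0 \<le> x $ i" for x :: "real ^ 'n"
    using that by (auto simp: pos_support_def vec_eq_iff less_le)
  \<comment> \<open>Indicator vectors realize every set as a support, so quantifying over vectors
    amounts to quantifying over sets.\<close>
  have "\<exists>x :: real ^ 'n. (\<forall>i. 0 \<le> x $ i) \<and> pos_support x = S" for S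
    by (rule exI[of _ "\<chi> i. if i \<in> S then 1 else 0"]) (auto simp: pos_support_def)
  then show ?thesis
    unfolding primitive_exponent_def using pos nonempty by metis
qed

theorem theorem4p2:
  fixes A :: "'n::finite tensor" and m :: nat
  assumes "m \<ge> 2"
    and "nonneg_tensor m A"
    and "primitive_tensor m A"
  shows "primitive_degree m A \<le> 2 ^ (CARD('n) ^ m)"
proof -
  let ?F = "support_map m A"
  obtain r where r: "0 < r" "\<And>S. S \<noteq> {} \<Longrightarrow> (?F ^^ r) S = UNIV"
    using assms by (auto simp: primitive_tensor_def primitive_exponent_iff_support_map)
  \<comment> \<open>The full set is a fixed point: as \<open>r > 0\<close>, its \<open>r\<close>-th
    iterate, again \<open>UNIV\<close>, is a value of \<open>?F\<close>, hence contained in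
    \<open>?F UNIV\<close> by monotonicity.\<close>
  have "UNIV = ?F ((?F ^^ (r - 1)) UNIV)"
    using r(1) r(2)[of UNIV] by (cases r) auto
  also have "\<dots> \<subseteq> ?F UNIV"
    by (rule support_map_mono) simp
  finally have "?F UNIV = UNIV" by blast
  then have "(?F ^^ CARD('n set)) S = UNIV" if "S \<noteq> {}" for S
    using r(2)[OF that] by (rule funpow_card_reaches_fixpoint)
  then have "primitive_exponent m A (2 ^ CARD('n))"
    using assms by (simp add: primitive_exponent_iff_support_map card_UNIV_set)
  then have "primitive_degree m A \<le> 2 ^ CARD('n)"
    unfolding primitive_degree_def by (rule Least_le)
  \<comment> \<open>The argument yields the bound \<open>2 ^ CARD('n)\<close>; the stated one
    follows from \<open>CARD('n) \<le> CARD('n) ^ m\<close>, as \<open>CARD('n) \<ge> 1\<close> and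
    \<open>m \<ge> 1\<close>.\<close>
  also have "(2::nat) ^ CARD('n) \<le> 2 ^ (CARD('n) ^ m)"
    using assms(1) by (intro power_increasing self_le_power) auto
  finally show ?thesis .
qed

end
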